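(* Let $X,Y$ be Banach lattices, let $p\in[1,\infty)$, and let $A$ generate a positive $C_0$-semigroup $\mathbb{T}=(T(t))_{t\ge0}$ on $X$. Assume that the adjoint $A^*$ is densely defined in the dual $X'$ and that there exist $\mu_0>s(A^* )$ and $c>0$ such that $$\Vert R(\mu_0,A^* )x^*\Vert\ \ge\ c\,\Vert x^*\Vert\qquad\text{for all }x^*\in X'_+ .$$ If $C\in\mathcal{L}(D(A),Y)$ is a positive operator, then $C$ is an $L^p$-admissible (positive) observation operator for $A$.
   Context: $X'$ is the topological dual of $X$ with the dual norm and dual order (a Banach lattice), with positive cone $X'_+$. $R(\mu,A^* )=(\mu I-A^* )^{-1}$, $s(A^* )=\sup\{\mathrm{Re}\,\mu:\mu\in\sigma(A^* )\}$. $D(A)$ carries the graph norm; $C\in\mathcal{L}(D(A),Y)$ is positive if $Cx\in Y_+$ for all $x\in D(A)\cap X_+$. $C$ is an $L^p$-admissible observation operator for $A$ if for some (hence all) $\alpha>0$ there is $\gamma=\gamma(\alpha)>0$ such that $\int_0^\alpha\Vert CT(t)x\Vert^p\,dt\le\gamma^p\Vert x\Vert^p$ for all $x\in D(A)$. *)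

theory Defs
  imports "HOL-Analysis.Analysis"
begin

class banach_lattice = banach + ordered_real_vector + lattice +
  assumes norm_mono_modulus: "sup x (- x) \<le> sup y (- y) \<Longrightarrow> norm x \<le> norm y"

text \<open>The dual \<open>X'\<close> is the type of bounded linear functionals \<open>'a \<Rightarrow>\<^sub>L real\<close>, whose norm is the dual norm.\<close>

definition dual_cone :: "('a::banach_lattice \<Rightarrow>\<^sub>L real) set" where
  "dual_cone = {\<phi>. \<forall>x\<ge>0. 0 \<le> blinfun_apply \<phi> x}"

text \<open>An unbounded operator is represented by its graph; its domain is \<^const>\<open>Domain\<close> of the graph.\<close>

type_synonym ('a, 'b) operator_graph = "('a \<times> 'b) set"

definition densely_defined :: "('a::topological_space, 'b) operator_graph \<Rightarrow> bool" where
  "densely_defined A \<longleftrightarrow> closure (Domain A) = UNIV"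

text \<open>This is the graph of an operator (i.e. single-valued) exactly when \<open>A\<close> is densely defined,
  as every generator of a strongly continuous semigroup is.\<close>

definition adjoint_graph ::
  "('a::real_normed_vector, 'a) operator_graph \<Rightarrow> ('a \<Rightarrow>\<^sub>L real, 'a \<Rightarrow>\<^sub>L real) operator_graph" where
  "adjoint_graph A = {(\<phi>, \<psi>). \<forall>(x, y)\<in>A. blinfun_apply \<phi> y = blinfun_apply \<psi> x}"

text \<open>The spectrum is that of the complexification: the pair \<open>(x, x')\<close> stands for \<open>x + \<i> x'\<close>.
  The product norm on pairs is equivalent to every usual norm on the complexification.\<close>

definition complex_scale :: "complex \<Rightarrow> 'a::real_vector \<times> 'a \<Rightarrow> 'a \<times> 'a" where
  "complex_scale \<mu> z =
    (Re \<mu> *\<^sub>R fst z - Im \<mu> *\<^sub>R snd z, Im \<mu> *\<^sub>R fst z + Re \<mu> *\<^sub>R snd z)"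

definition complexification :: "('a, 'b) operator_graph \<Rightarrow> ('a \<times> 'a, 'b \<times> 'b) operator_graph" where
  "complexification A = {((x, x'), (y, y')). (x, y) \<in> A \<and> (x', y') \<in> A}"

text \<open>Below, \<open>R\<close> is a bounded two-sided inverse of \<open>\<mu> I - A\<close>. It is required to be real-linear only;
  as the inverse of a complex-linear map it is then complex-linear.\<close>

definition resolvent_set :: "('a::real_normed_vector, 'a) operator_graph \<Rightarrow> complex set" where
  "resolvent_set A = {\<mu>. \<exists>R. bounded_linear R \<and>
     (\<forall>(z, w)\<in>complexification A. R (complex_scale \<mu> z - w) = z) \<and>
     (\<forall>v. (R v, complex_scale \<mu> (R v) - v) \<in> complexification A)}"

definition spectrum :: "('a::real_normed_vector, 'a) operator_graph \<Rightarrow> complex set" where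
  "spectrum A = - resolvent_set A"

text \<open>Extended-real valued: \<open>-\<infinity>\<close> if the spectrum is empty, \<open>\<infinity>\<close> if it is unbounded to the right.\<close>

definition spectral_bound :: "('a::real_normed_vector, 'a) operator_graph \<Rightarrow> ereal" where
  "spectral_bound A = (SUP \<mu>\<in>spectrum A. ereal (Re \<mu>))"

text \<open>For real \<open>\<mu>\<close> in the resolvent set, \<open>\<mu> I - A\<close> is already bijective on the real space:
  \<open>resolvent \<mu> A v\<close> is the unique \<open>u\<close> in the domain with \<open>\<mu> u - A u = v\<close>.\<close>

definition resolvent :: "real \<Rightarrow> ('a::real_normed_vector, 'a) operator_graph \<Rightarrow> 'a \<Rightarrow> 'a" where
  "resolvent \<mu> A v = (THE u. (u, \<mu> *\<^sub>R u - v) \<in> A)"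

text \<open>Only the values \<open>T t\<close> for \<open>t \<ge> 0\<close> matter.\<close>

definition c0_semigroup :: "(real \<Rightarrow> 'a::real_normed_vector \<Rightarrow>\<^sub>L 'a) \<Rightarrow> bool" where
  "c0_semigroup T \<longleftrightarrow>
     T 0 = id_blinfun \<and>
     (\<forall>s\<ge>0. \<forall>t\<ge>0. T (s + t) = T s o\<^sub>L T t) \<and>
     (\<forall>x. ((\<lambda>t. T t x) \<longlongrightarrow> x) (at_right 0))"

definition generator :: "(real \<Rightarrow> 'a::real_normed_vector \<Rightarrow>\<^sub>L 'a) \<Rightarrow> ('a, 'a) operator_graph" where
  "generator T = {(x, y). ((\<lambda>t. (1 / t) *\<^sub>R (T t x - x)) \<longlongrightarrow> y) (at_right 0)}"

definition positive_semigroup :: "(real \<Rightarrow> 'a::banach_lattice \<Rightarrow>\<^sub>L 'a) \<Rightarrow> bool" where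
  "positive_semigroup T \<longleftrightarrow> (\<forall>t\<ge>0. \<forall>x\<ge>0. 0 \<le> T t x)"

text \<open>\<open>C \<in> L(D(A), Y)\<close>, where \<open>D(A)\<close> carries the graph norm \<open>\<parallel>x\<parallel> + \<parallel>A x\<parallel>\<close>.
  The values of \<open>C\<close> outside \<open>D(A)\<close> are irrelevant.\<close>

definition graph_bounded_linear ::
  "('a::real_normed_vector, 'a) operator_graph \<Rightarrow> ('a \<Rightarrow> 'b::real_normed_vector) \<Rightarrow> bool" where
  "graph_bounded_linear A C \<longleftrightarrow>
     (\<forall>x\<in>Domain A. \<forall>x'\<in>Domain A. C (x + x') = C x + C x') \<and>
     (\<forall>r. \<forall>x\<in>Domain A. C (r *\<^sub>R x) = r *\<^sub>R C x) \<and>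
     (\<exists>K. \<forall>(x, y)\<in>A. norm (C x) \<le> K * (norm x + norm y))"

definition positive_on_domain ::
  "('a::banach_lattice, 'a) operator_graph \<Rightarrow> ('a \<Rightarrow> 'b::banach_lattice) \<Rightarrow> bool" where
  "positive_on_domain A C \<longleftrightarrow> (\<forall>x\<in>Domain A. 0 \<le> x \<longrightarrow> 0 \<le> C x)"

text \<open>Admissibility for one \<open>\<alpha> > 0\<close> is equivalent to admissibility for all \<open>\<alpha> > 0\<close>. The integrability
  clause excludes the value 0 which the integral takes by convention for non-integrable functions;
  it holds whenever \<open>T\<close> is the semigroup generated by \<open>A\<close>, since then the integrand is continuous.\<close>

definition Lp_admissible ::
  "real \<Rightarrow> (real \<Rightarrow> 'a::real_normed_vector \<Rightarrow>\<^sub>L 'a) \<Rightarrow> ('a, 'a) operator_graph \<Rightarrow>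
    ('a \<Rightarrow> 'b::real_normed_vector) \<Rightarrow> bool" where
  "Lp_admissible p T A C \<longleftrightarrow>
     graph_bounded_linear A C \<and>
     (\<exists>\<alpha>>0. \<exists>\<gamma>>0. \<forall>x\<in>Domain A.
        set_integrable lborel {0..\<alpha>} (\<lambda>t. norm (C (T t x)) powr p) \<and>
        (LINT t:{0..\<alpha>}|lborel. norm (C (T t x)) powr p) \<le> \<gamma> powr p * norm x powr p)"

end

theory Submission
  imports Defs
begin

text \<open>The hypotheses force \<open>C\<close> to be bounded on \<open>D(A)\<close> for the norm of \<open>X\<close>, so admissibility is
  immediate for every \<open>p\<close>. Let \<open>V\<^sub>h = h\<^sup>-\<^sup>1 \<integral>\<^sub>0\<^sup>h S(t) dt\<close> for a rescaling \<open>S\<close> of \<open>T\<close>, and let \<open>f\<close> be a positive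
  functional on \<open>Y\<close> of norm at most 1. Then \<open>\<phi> = f \<circ> C \<circ> V\<^sub>h\<close> is a positive functional on \<open>X\<close>, and
  the inverse estimate bounds \<open>\<parallel>\<phi>\<parallel>\<close> by a multiple of \<open>\<parallel>\<phi> \<circ> W\<parallel>\<close>, where \<open>W\<close> is an approximate
  resolvent of \<open>A\<close>. Since \<open>W\<close> commutes with \<open>V\<^sub>h\<close> and \<open>C W\<close> is bounded on \<open>X\<close>, this bound is uniform in
  \<open>h\<close>. Positive functionals norm \<open>Y\<close> up to a factor 2 by the Hahn--Banach theorem, and
  \<open>C V\<^sub>h x\<close> tends to \<open>C x\<close> as \<open>h\<close> tends to 0.\<close>

subsection \<open>The Hahn--Banach theorem for sublinear functionals\<close>

definition sublinear :: "('a::real_vector \<Rightarrow> real) \<Rightarrow> bool" where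
  "sublinear q \<longleftrightarrow> (\<forall>x y. q (x + y) \<le> q x + q y) \<and> (\<forall>r\<ge>0. \<forall>x. q (r *\<^sub>R x) = r * q x)"

lemma sublinear_add: "sublinear q \<Longrightarrow> q (x + y) \<le> q x + q y"
  and sublinear_scale: "sublinear q \<Longrightarrow> 0 \<le> r \<Longrightarrow> q (r *\<^sub>R x) = r * q x"
  by (auto simp: sublinear_def)

lemma sublinear_zero: "sublinear q \<Longrightarrow> q 0 = 0"
  using sublinear_scale[of q 0 0] by simp

lemma sublinear_minus: "sublinear q \<Longrightarrow> - q (- x) \<le> q x"
  using sublinear_add[of q x "- x"] sublinear_zero[of q] by simp

text \<open>The converse scaling inequality comes from applying \<open>scale\<close> with factor
  \<open>1 / r\<close> to \<open>r *\<^sub>R x\<close>. For \<open>r = 0\<close> it reads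
  \<open>0 \<le> q 0\<close>, which follows from subadditivity.\<close>

lemma sublinearI:
  fixes q :: "'a::real_vector \<Rightarrow> real"
  assumes add: "\<And>x y. q (x + y) \<le> q x + q y" 
    and scale: "\<And>r x. 0 \<le> r \<Longrightarrow> q (r *\<^sub>R x) \<le> r * q x"
  shows "sublinear q"
  unfolding sublinear_def
proof (intro conjI allI impI antisym)
  fix r :: real and x
  assume r: "0 \<le> r"
  show "r * q x \<le> q (r *\<^sub>R x)"
  proof (cases "r = 0")
    case True
    then show ?thesis using add[of 0 0] by simp
  next
    case False
    then have "q x \<le> (1 / r) * q (r *\<^sub>R x)"
      using scale[of "1 / r" "r *\<^sub>R x"] r by simp
    then show ?thesis using r False by (simp add: field_simps)
  qed
qed (use assms in auto)

text \<open>Lowering a sublinear functional along the ray spanned by \<open>y\<close> makes it odd at \<open>y\<close>.\<close>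

lemma sublinear_lower:
  assumes q: "sublinear q"
  obtains q' where "sublinear q'" "\<And>x. q' x \<le> q x" "q' (- y) \<le> - q y"
proof -
  \<comment> \<open>Subadditivity bounds the infimum below by \<open>- q (- x)\<close>. The choice
    \<open>t = 0\<close> gives \<open>q' \<le> q\<close>, and \<open>t = 1\<close> at
    \<open>- y\<close> gives the value \<open>q 0 - q y = - q y\<close>.\<close>
  define q' where "q' x = (INF t\<in>{0..}. q (x + t *\<^sub>R y) - t * q y)" for x
  have bdd: "bdd_below ((\<lambda>t. q (x + t *\<^sub>R y) - t * q y) ` {0..})" for x
  proof (rule bdd_belowI2[where m = "- q (- x)"])
    fix t :: real assume "t \<in> {0..}"
    then have "t * q y = q ((x + t *\<^sub>R y) + - x)" using sublinear_scale[OF q, of t y] by simp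
    then show "- q (- x) \<le> q (x + t *\<^sub>R y) - t * q y"
      using sublinear_add[OF q, of "x + t *\<^sub>R y" "- x"] by linarith
  qed
  have low: "q' x \<le> q (x + t *\<^sub>R y) - t * q y" if "0 \<le> t" for x t
    unfolding q'_def using that by (intro cINF_lower bdd) auto
  have great: "m \<le> q' x" if "\<And>t. 0 \<le> t \<Longrightarrow> m \<le> q (x + t *\<^sub>R y) - t * q y" for m x
    unfolding q'_def using that by (intro cINF_greatest) auto
  have "sublinear q'"
  proof (rule sublinearI)
    fix x z
    \<comment> \<open>Parameters \<open>s\<close> for \<open>x\<close> and \<open>t\<close> for
      \<open>z\<close> combine into the parameter \<open>s + t\<close> for \<open>x + z\<close>.
      Taking the infimum first over \<open>s\<close> and then over \<open>t\<close> yields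
      subadditivity.\<close>
    have "q' (x + z) - (q (z + t *\<^sub>R y) - t * q y) \<le> q (x + s *\<^sub>R y) - s * q y" 
      if "0 \<le> s" "0 \<le> t" for s t
    proof -
      have eq: "x + z + (s + t) *\<^sub>R y = (x + s *\<^sub>R y) + (z + t *\<^sub>R y)"
        by (simp add: scaleR_add_left)
      have "q (x + z + (s + t) *\<^sub>R y) \<le> q (x + s *\<^sub>R y) + q (z + t *\<^sub>R y)"
        unfolding eq by (rule sublinear_add[OF q])
      then show ?thesis
        using low[of "s + t" "x + z"] that by (simp add: algebra_simps)
    qed
    then have "q' (x + z) - (q (z + t *\<^sub>R y) - t * q y) \<le> q' x" if "0 \<le> t" for t
      using that by (intro great) auto
    then have "q' (x + z) - q' x \<le> q (z + t *\<^sub>R y) - t * q y" if "0 \<le> t" for t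
      using that by (simp add: algebra_simps)
    then have "q' (x + z) - q' x \<le> q' z" by (rule great)
    then show "q' (x + z) \<le> q' x + q' z" by simp
  next
    fix r :: real and x assume r: "0 \<le> r"
    show "q' (r *\<^sub>R x) \<le> r * q' x"
    proof (cases "r = 0")
      case True
      then show ?thesis using low[of 0 0] sublinear_zero[OF q] by simp
    next
      case False
      have "q' (r *\<^sub>R x) / r \<le> q (x + t *\<^sub>R y) - t * q y" if "0 \<le> t" for t
      proof -
        have "r *\<^sub>R x + (r * t) *\<^sub>R y = r *\<^sub>R (x + t *\<^sub>R y)" by (simp add: scaleR_add_right)
        then have "q (r *\<^sub>R x + (r * t) *\<^sub>R y) = r * q (x + t *\<^sub>R y)"
          using sublinear_scale[OF q r] by simp
        then have "q' (r *\<^sub>R x) \<le> (q (x + t *\<^sub>R y) - t * q y) * r"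
          using low[of "r * t" "r *\<^sub>R x"] r that by (simp add: algebra_simps)
        then show ?thesis using r False by (simp add: divide_le_eq)
      qed
      then have "q' (r *\<^sub>R x) / r \<le> q' x" by (rule great)
      then show ?thesis using r False by (simp add: divide_le_eq mult.commute)
    qed
  qed
  moreover have "q' x \<le> q x" for x using low[of 0 x] by simp
  moreover have "q' (- y) \<le> - q y" using low[of 1 "- y"] sublinear_zero[OF q] by simp
  ultimately show thesis by (rule that)
qed

text \<open>Zorn's lemma for the reversed pointwise order. A nonempty chain has its pointwise
  infimum as a lower bound, which is finite because each member is at least \<open>- p (- x)\<close>
  at \<open>x\<close>.\<close>

lemma sublinear_minimal:
  fixes p :: "'a::real_vector \<Rightarrow> real"
  assumes p: "sublinear p"
  obtains q where "sublinear q" "q \<le> p" "\<And>q'. sublinear q' \<Longrightarrow> q' \<le> q \<Longrightarrow> q' = q"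
proof -
  define Q where "Q = {q. sublinear q \<and> q \<le> p}"
  have "\<exists>m\<in>Q. \<forall>a\<in>Q. (\<lambda>x y. y \<le> x) m a \<longrightarrow> a = m"
  proof (rule predicate_Zorn)
    show "partial_order_on Q (relation_of (\<lambda>x y. y \<le> x) Q)"
      by (rule partial_order_on_relation_ofI) auto
    fix C assume "C \<in> Chains (relation_of (\<lambda>x y. y \<le> x) Q)"
    then have CQ: "C \<subseteq> Q" and chain: "\<And>a b. a \<in> C \<Longrightarrow> b \<in> C \<Longrightarrow> a \<le> b \<or> b \<le> a"
      by (auto simp: Chains_def relation_of_def)
    show "\<exists>u\<in>Q. \<forall>a\<in>C. u \<le> a"
    proof (cases "C = {}")
      case True
      then show ?thesis using p by (auto simp: Q_def)
    next
      case False
      define u where "u x = (INF q\<in>C. q x)" for x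
      have sub: "sublinear q" and le: "q x \<le> p x" if "q \<in> C" for q x
        using that CQ by (auto simp: Q_def le_fun_def)
      have "bdd_below ((\<lambda>q. q x) ` C)" for x
      proof (rule bdd_belowI2[where m = "- p (- x)"])
        fix q assume "q \<in> C"
        then show "- p (- x) \<le> q x"
          using sublinear_minus[OF sub, of q x] le[of q "- x"] by linarith
      qed
      then have low: "u x \<le> q x" if "q \<in> C" for q x
        unfolding u_def using that by (intro cINF_lower) auto
      have great: "m \<le> u x" if "\<And>q. q \<in> C \<Longrightarrow> m \<le> q x" for m x
        unfolding u_def using that False by (intro cINF_greatest) auto
      have "sublinear u"
      proof (rule sublinearI)
        fix x y
        \<comment> \<open>In a chain the smaller of \<open>a\<close> and \<open>b\<close> lies below
          both, so subadditivity of that single functional suffices.\<close>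
        have "u (x + y) \<le> a x + b y" if "a \<in> C" "b \<in> C" for a b
        proof -
          from that chain have "\<exists>q\<in>C. q \<le> a \<and> q \<le> b" by (meson order_refl)
          then obtain q where q: "q \<in> C" "q \<le> a" "q \<le> b" by blast
          have "u (x + y) \<le> q x + q y"
            using low[OF q(1), of "x + y"] sublinear_add[OF sub[OF q(1)], of x y] by linarith
          also have "\<dots> \<le> a x + b y" using q by (intro add_mono) (auto simp: le_fun_def)
          finally show ?thesis .
        qed
        then have *: "u (x + y) - b y \<le> u x" if "b \<in> C" for b
          using that by (intro great) (simp add: diff_le_eq)
        have "u (x + y) - u x \<le> u y"
        proof (rule great)
          fix b assume "b \<in> C" 
          from *[OF this] show "u (x + y) - u x \<le> b y" by linarith
        qed
        then show "u (x + y) \<le> u x + u y" by simp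
      next
        fix r :: real and x assume r: "0 \<le> r"
        show "u (r *\<^sub>R x) \<le> r * u x"
        proof (cases "r = 0")
          case True
          then show ?thesis using low[of _ 0] False sub sublinear_zero by fastforce
        next
          case nz: False
          have "u (r *\<^sub>R x) / r \<le> u x"
          proof (rule great)
            fix q assume "q \<in> C"
            then have "u (r *\<^sub>R x) \<le> q x * r"
              using low[of q "r *\<^sub>R x"] sublinear_scale[OF sub r, of q x] by (simp add: mult.commute)
            then show "u (r *\<^sub>R x) / r \<le> q x" using r nz by (simp add: divide_le_eq)
          qed
          then show ?thesis using r nz by (simp add: divide_le_eq mult.commute)
        qed
      qed
      moreover have "u x \<le> p x" for x
      proof -
        obtain q where "q \<in> C" using False by blast
        then show ?thesis using low[of q x] le[of q x] by simp
      qed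
      ultimately have "u \<in> Q" by (simp add: Q_def le_fun_def)
      then show ?thesis using low by (auto simp: le_fun_def)
    qed
  qed
  then obtain q where "q \<in> Q" and min: "\<And>a. a \<in> Q \<Longrightarrow> a \<le> q \<Longrightarrow> a = q" by blast
  show thesis
  proof (rule that)
    show "sublinear q" "q \<le> p" using \<open>q \<in> Q\<close> by (auto simp: Q_def)
    fix q' assume "sublinear q'" "q' \<le> q"
    then show "q' = q" using \<open>q \<in> Q\<close> by (intro min) (auto simp: Q_def)
  qed
qed

text \<open>A minimal sublinear functional is linear: lowering it along any \<open>y\<close> gives
  back the same functional, so it is odd, and odd sublinear functionals are additive and
  homogeneous. To attain \<open>p z\<close>, the functional \<open>p\<close> is first lowered along
  \<open>z\<close>; then \<open>f (- z) \<le> - p z\<close> forces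
  \<open>f z \<ge> p z\<close>.\<close>

theorem hahn_banach_dominated:
  fixes p :: "'a::real_vector \<Rightarrow> real"
  assumes p: "sublinear p"
  obtains f where "linear f" "\<And>x. f x \<le> p x" "f z = p z"
proof -
  obtain pz where pz: "sublinear pz" "\<And>x. pz x \<le> p x" "pz (- z) \<le> - p z"
    using sublinear_lower[OF p] by blast
  obtain f where f: "sublinear f" "f \<le> pz" and min: "\<And>q'. sublinear q' \<Longrightarrow> q' \<le> f \<Longrightarrow> q' = f"
    using sublinear_minimal[OF pz(1)] by blast
  have odd: "f (- y) = - f y" for y
  proof -
    obtain g where g: "sublinear g" "\<And>x. g x \<le> f x" "g (- y) \<le> - f y"
      using sublinear_lower[OF f(1)] by blast
    then have "g = f" by (intro min) (auto simp: le_fun_def)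
    then show ?thesis using g(3) sublinear_minus[OF f(1), of y] by auto
  qed
  have le: "f x \<le> p x" for x using f(2) pz(2) by (meson le_funD order_trans)
  have "f (x + y) = f x + f y" for x y
  proof (rule antisym)
    have "f (- x + - y) \<le> f (- x) + f (- y)" by (rule sublinear_add[OF f(1)])
    moreover have "- x + - y = - (x + y)" by simp
    ultimately show "f x + f y \<le> f (x + y)" by (simp only: odd)
  qed (rule sublinear_add[OF f(1)])
  moreover have "f (r *\<^sub>R x) = r * f x" for r x
  proof (cases "0 \<le> r")
    case False
    then show ?thesis using sublinear_scale[OF f(1), of "- r" x] odd[of "r *\<^sub>R x"] by simp
  qed (simp add: sublinear_scale[OF f(1)])
  ultimately have "linear f" by (intro linearI) auto
  moreover have "f z = p z"
  proof (rule antisym[OF le])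
    have "- f z \<le> - p z" using f(2) pz(3) odd[of z] by (metis le_funD order_trans)
    then show "p z \<le> f z" by simp
  qed
  ultimately show thesis using le by (intro that)
qed

subsection \<open>Banach lattices\<close>

lemma sup_add_distrib_right:
  fixes x :: "'a::banach_lattice"
  shows "sup x y + z = sup (x + z) (y + z)"
proof (rule antisym)
  have "sup x y \<le> sup (x + z) (y + z) - z"
    by (rule sup_least) (simp_all add: le_diff_eq)
  then show "sup x y + z \<le> sup (x + z) (y + z)" by (simp add: le_diff_eq)
qed (auto intro: add_right_mono)

lemma nonneg_sup_minus:
  fixes x :: "'a::banach_lattice"
  shows "0 \<le> sup x (- x)"
proof -
  have "x + - x \<le> sup x (- x) + sup x (- x)" by (intro add_mono) auto
  then have "0 \<le> (1 / 2) *\<^sub>R (sup x (- x) + sup x (- x))" by (intro scaleR_nonneg_nonneg) auto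
  then show ?thesis by (simp add: scaleR_half_double)
qed

lemma sup_minus_of_nonneg:
  fixes x :: "'a::banach_lattice"
  shows "0 \<le> x \<Longrightarrow> sup x (- x) = x"
  by (rule sup_absorb1) (meson neg_le_0_iff_le order_trans)

lemma norm_mono_nonneg:
  fixes x :: "'a::banach_lattice"
  shows "0 \<le> x \<Longrightarrow> x \<le> y \<Longrightarrow> norm x \<le> norm y"
  by (rule norm_mono_modulus) (auto simp: sup_minus_of_nonneg intro: order_trans)

lemma norm_sup_zero_le:
  fixes x :: "'a::banach_lattice"
  shows "norm (sup x 0) \<le> norm x"
  by (rule norm_mono_modulus) (simp add: sup_minus_of_nonneg nonneg_sup_minus)

lemma sup_zero_diff:
  fixes x :: "'a::banach_lattice"
  shows "sup x 0 - sup (- x) 0 = x"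
  using sup_add_distrib_right[of "- x" 0 x] by (simp add: sup_commute algebra_simps)

text \<open>This is the majorant for the Hahn-Banach theorem. It vanishes at \<open>- x\<close> for
  \<open>x \<ge> 0\<close>, so a linear functional below it is positive; it is at most the norm, so
  such a functional has norm at most 1.\<close>

lemma sublinear_norm_sup_zero: "sublinear (\<lambda>x::'a::banach_lattice. norm (sup x 0))"
proof (rule sublinearI)
  fix x y :: 'a
  have "norm (sup (x + y) 0) \<le> norm (sup x 0 + sup y 0)"
    by (rule norm_mono_nonneg) (auto intro: add_mono)
  then show "norm (sup (x + y) 0) \<le> norm (sup x 0) + norm (sup y 0)"
    using norm_triangle_ineq order_trans by blast
next
  fix r :: real and x :: 'a
  assume r: "0 \<le> r"
  have "norm (sup (r *\<^sub>R x) 0) \<le> norm (r *\<^sub>R sup x 0)"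
    using r by (intro norm_mono_nonneg sup_least scaleR_left_mono scaleR_nonneg_nonneg) auto
  then show "norm (sup (r *\<^sub>R x) 0) \<le> r * norm (sup x 0)" using r by simp
qed

lemma positive_norming_functional:
  fixes z :: "'a::banach_lattice"
  obtains f :: "'a \<Rightarrow>\<^sub>L real" where "f \<in> dual_cone" "norm f \<le> 1" "f z = norm (sup z 0)"
proof -
  obtain g where g: "linear g" "\<And>x. g x \<le> norm (sup x (0::'a))" "g z = norm (sup z 0)"
    using hahn_banach_dominated[OF sublinear_norm_sup_zero] by blast
  interpret g: linear g by fact
  have up: "g x \<le> norm x" for x using g(2) norm_sup_zero_le order_trans by blast
  have abs: "norm (g x) \<le> norm x * 1" for x
    using up[of x] up[of "- x"] by (auto simp: g.neg abs_le_iff)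
  then have bl: "bounded_linear g"
    by (intro bounded_linear.intro g.linear_axioms bounded_linear_axioms.intro) blast
  show thesis
  proof (rule that)
    show "Blinfun g \<in> dual_cone"
      unfolding dual_cone_def
    proof (safe)
      fix x :: 'a assume "0 \<le> x"
      then have "sup (- x) 0 = 0" by (intro sup_absorb2) auto
      then show "0 \<le> Blinfun g x"
        using g(2)[of "- x"] by (simp add: bounded_linear_Blinfun_apply[OF bl] g.neg)
    qed
    show "norm (Blinfun g) \<le> 1"
      using abs by (intro norm_blinfun_bound) (auto simp: bounded_linear_Blinfun_apply[OF bl])
    show "Blinfun g z = norm (sup z 0)" using g(3) by (simp add: bounded_linear_Blinfun_apply[OF bl])
  qed
qed

lemma closed_nonneg: "closed {x::'a::banach_lattice. 0 \<le> x}"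
  unfolding closed_sequential_limits
proof safe
  fix X :: "nat \<Rightarrow> 'a" and l
  assume X: "\<forall>n. X n \<in> {x. 0 \<le> x}" and lim: "X \<longlonglongrightarrow> l"
  have "norm (sup (- l) 0) \<le> norm (l - X n)" for n
  proof (rule norm_mono_modulus)
    \<comment> \<open>Since \<open>X n\<close> is nonnegative, the negative part of \<open>l\<close>
      is dominated by the modulus of \<open>l - X n\<close>, whose norm tends to 0.\<close>
    have "- l \<le> - (l - X n)" using X by simp
    then have "- l \<le> sup (l - X n) (- (l - X n))" by (rule le_supI2)
    then show "sup (sup (- l) 0) (- sup (- l) 0) \<le> sup (l - X n) (- (l - X n))"
      by (simp only: sup_minus_of_nonneg sup_ge2 sup_least nonneg_sup_minus)
  qed
  moreover have "(\<lambda>n. norm (l - X n)) \<longlonglongrightarrow> 0"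
    using tendsto_norm[OF tendsto_diff[OF tendsto_const[of l] lim]] by simp
  ultimately have "norm (sup (- l) 0) \<le> 0" by (meson LIMSEQ_le_const)
  then have "sup (- l) 0 = 0" by simp
  then show "0 \<le> l" by (metis neg_le_0_iff_le sup_ge1)
qed

text \<open>The integral is approximated by Riemann sums, which lie in the positive cone, and the
  cone is closed.\<close>

lemma has_integral_nonneg_banach_lattice:
  fixes f :: "real \<Rightarrow> 'a::banach_lattice"
  assumes int: "(f has_integral I) {a..b}" and nonneg: "\<And>t. t \<in> {a..b} \<Longrightarrow> 0 \<le> f t"
  shows "0 \<le> I"
proof -
  have "\<exists>y\<in>{x. 0 \<le> x}. dist y I < e" if e: "e > 0" for e
  proof -
    from has_integral_real[THEN iffD1, OF int, rule_format, OF e]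
    obtain \<gamma> where \<gamma>: "gauge \<gamma> \<and> (\<forall>\<D>. \<D> tagged_division_of {a..b} \<and> \<gamma> fine \<D> \<longrightarrow>
        norm (sum (\<lambda>(x,k). measure lborel k *\<^sub>R f x) \<D> - I) < e)" ..
    then have "gauge \<gamma>" ..
    obtain \<D> where \<D>: "\<D> tagged_division_of {a..b}" "\<gamma> fine \<D>"
      using fine_division_exists_real[OF \<open>gauge \<gamma>\<close>] .
    have "0 \<le> sum (\<lambda>(x,k). measure lborel k *\<^sub>R f x) \<D>"
      using tag_in_interval[OF \<D>(1)] nonneg
      by (intro sum_nonneg) (auto intro!: scaleR_nonneg_nonneg)
    moreover have "dist (sum (\<lambda>(x,k). measure lborel k *\<^sub>R f x) \<D>) I < e"
      unfolding dist_norm using \<gamma> \<D> by (elim conjE allE[of _ \<D>] impE) (rule conjI)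
    ultimately show ?thesis by (intro bexI[of _ "sum (\<lambda>(x,k). measure lborel k *\<^sub>R f x) \<D>"]) simp_all
  qed
  then have "I \<in> closure {x. 0 \<le> x}" by (simp add: closure_approachable)
  then show ?thesis using closure_closed[OF closed_nonneg] by auto
qed

subsection \<open>Strongly continuous semigroups\<close>

lemma c0_semigroup_zero: "c0_semigroup T \<Longrightarrow> T 0 x = x"
  and c0_semigroup_add: "c0_semigroup T \<Longrightarrow> 0 \<le> s \<Longrightarrow> 0 \<le> t \<Longrightarrow> T (s + t) x = T s (T t x)"
  and c0_semigroup_tendsto: "c0_semigroup T \<Longrightarrow> ((\<lambda>t. T t x) \<longlongrightarrow> x) (at_right 0)"
  by (auto simp: c0_semigroup_def)

lemma c0_semigroup_commute:
  "c0_semigroup T \<Longrightarrow> 0 \<le> s \<Longrightarrow> 0 \<le> t \<Longrightarrow> T s (T t x) = T t (T s x)"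
  by (metis add.commute c0_semigroup_add)

lemma c0_semigroup_near_zero:
  fixes T :: "real \<Rightarrow> 'a::real_normed_vector \<Rightarrow>\<^sub>L 'a"
  assumes T: "c0_semigroup T" and "0 < e"
  obtains d where "0 < d" "\<And>t. 0 \<le> t \<Longrightarrow> t < d \<Longrightarrow> norm (T t x - x) < e"
proof -
  have "\<forall>\<^sub>F t in at_right 0. dist (T t x) x < e"
    using c0_semigroup_tendsto[OF T] \<open>0 < e\<close> by (rule tendstoD)
  then obtain d where d: "0 < d" "\<And>t. 0 < t \<Longrightarrow> t < d \<Longrightarrow> dist (T t x) x < e"
    unfolding eventually_at_right_field by auto
  have "norm (T t x - x) < e" if "0 \<le> t" "t < d" for t
    using d(2)[of t] that \<open>0 < e\<close> by (cases "t = 0") (auto simp: dist_norm c0_semigroup_zero[OF T])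
  with d(1) show thesis by (rule that)
qed

text \<open>Each orbit is bounded near 0, on an interval that depends on the vector. The Baire
  category theorem makes both the bound and the interval uniform.\<close>

lemma c0_semigroup_bounded_near_zero:
  fixes T :: "real \<Rightarrow> 'a::banach \<Rightarrow>\<^sub>L 'a"
  assumes T: "c0_semigroup T"
  obtains d M where "0 < d" "\<And>t. 0 \<le> t \<Longrightarrow> t \<le> d \<Longrightarrow> norm (T t) \<le> M"
proof -
  \<comment> \<open>One index governs both the bound and the length of the interval, so countably
    many closed sets cover the space.\<close>
  define E where "E n = {x. \<forall>t\<in>{0..1 / real (Suc n)}. norm (T t x) \<le> real n}" for n
  have closed: "closed (E n)" for n
  proof -
    have "E n = (\<Inter>t\<in>{0..1 / real (Suc n)}. {x. norm (T t x) \<le> real n})" by (auto simp: E_def)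
    also have "closed \<dots>"
      by (intro closed_INT ballI closed_Collect_le continuous_intros)
    finally show ?thesis .
  qed
  have "\<exists>n. x \<in> E n" for x
  proof -
    obtain d where d: "0 < d" "\<And>t. 0 \<le> t \<Longrightarrow> t < d \<Longrightarrow> norm (T t x - x) < 1"
      using c0_semigroup_near_zero[OF T, of 1 x] by auto
    obtain n where n: "real n > max (norm x + 1) (1 / d)" using reals_Archimedean2 by blast
    then have "1 / d < real (Suc n)" by simp
    then have "1 / real (Suc n) < d" using d(1) by (simp add: field_simps)
    moreover have "norm (T t x) \<le> real n" if "0 \<le> t" "t < d" for t
      using d(2)[OF that] norm_triangle_sub[of "T t x" x] n by linarith
    ultimately have "x \<in> E n" by (auto simp: E_def)
    then show ?thesis ..
  qed
  then have "\<Union> (range E) = UNIV" by blast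
  then have "euclidean interior_of \<Union> (range E) \<noteq> {}" by simp
  then have "\<exists>n. interior (E n) \<noteq> {}"
    using Baire_category_alt[of "euclidean :: 'a topology" "range E"] closed
      completely_metrizable_space_euclidean[where 'a = 'a]
    by auto
  then obtain n x0 r where r: "0 < r" "ball x0 r \<subseteq> E n"
    using mem_interior by blast
  have "norm (T t) \<le> 4 * real n / r" if t: "0 \<le> t" "t \<le> 1 / real (Suc n)" for t
  proof (rule norm_blinfun_bound)
    show "0 \<le> 4 * real n / r" using r by simp
    fix x
    show "norm (T t x) \<le> 4 * real n / r * norm x"
    proof (cases "x = 0")
      case False
      \<comment> \<open>Rescaling to norm \<open>r / 2\<close> keeps \<open>x0 + y\<close> in the
        ball. Then \<open>T t y\<close> is a difference of two vectors of norm at most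
        \<open>n\<close>, and \<open>2 * n\<close> divided by \<open>r / 2\<close> gives the
        constant.\<close>
      define y where "y = (r / 2 / norm x) *\<^sub>R x"
      have "norm y = r / 2" using False r by (simp add: y_def)
      then have "x0 + y \<in> ball x0 r" "x0 \<in> ball x0 r" using r by (auto simp: dist_norm)
      then have "x0 + y \<in> E n" "x0 \<in> E n" using r(2) by blast+
      then have "norm (T t (x0 + y)) \<le> real n" "norm (T t x0) \<le> real n"
        using t by (auto simp: E_def)
      moreover have eq: "T t y = T t (x0 + y) - T t x0" by (simp add: blinfun.add_right)
      ultimately have "norm (T t y) \<le> 2 * real n"
        unfolding eq using norm_triangle_ineq4[of "T t (x0 + y)" "T t x0"] by linarith
      then have "r / 2 / norm x * norm (T t x) \<le> 2 * real n"
        using r by (simp add: y_def blinfun.scaleR_right)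
      then show ?thesis using r False by (simp add: field_simps)
    qed simp
  qed
  then show thesis by (intro that[of "1 / real (Suc n)"]) auto
qed

lemma c0_semigroup_bounded:
  fixes T :: "real \<Rightarrow> 'a::banach \<Rightarrow>\<^sub>L 'a"
  assumes T: "c0_semigroup T"
  obtains M where "1 \<le> M" "\<And>t. 0 \<le> t \<Longrightarrow> t \<le> b \<Longrightarrow> norm (T t) \<le> M"
proof -
  obtain d M where d: "0 < d" and M: "\<And>t. 0 \<le> t \<Longrightarrow> t \<le> d \<Longrightarrow> norm (T t) \<le> M"
    using c0_semigroup_bounded_near_zero[OF T] by blast
  \<comment> \<open>The maximum with 1 makes the powers of \<open>N\<close> increasing, so the
    induction may also use the bound for short times.\<close>
  define N where "N = max 1 M"
  have N: "1 \<le> N" by (simp add: N_def)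
  have ind: "norm (T t) \<le> N ^ Suc n" if "0 \<le> t" "t \<le> d * real (Suc n)" for n t
    using that
  proof (induction n arbitrary: t)
    case 0
    then show ?case using M[of t] by (simp add: N_def le_max_iff_disj)
  next
    case (Suc n)
    show ?case
    proof (cases "t \<le> d")
      case True
      then have "norm (T t) \<le> N" using M Suc.prems by (simp add: N_def le_max_iff_disj)
      also have "\<dots> \<le> N ^ Suc (Suc n)" using N by (rule self_le_power) simp
      finally show ?thesis .
    next
      case False
      have "T t = T (d + (t - d))" by simp
      also have "\<dots> = T d o\<^sub>L T (t - d)"
        using T d False unfolding c0_semigroup_def by (metis diff_ge_0_iff_ge less_imp_le not_le)
      also have "norm \<dots> \<le> norm (T d) * norm (T (t - d))" by (rule norm_blinfun_compose)
      also have "\<dots> \<le> N * N ^ Suc n"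
        using Suc False M[of d] d N
        by (intro mult_mono Suc.IH) (auto simp: algebra_simps N_def le_max_iff_disj)
      finally show ?thesis by simp
    qed
  qed
  obtain n where n: "real n > b / d" using reals_Archimedean2 by blast
  then have "b \<le> d * real (Suc n)" using d by (simp add: field_simps)
  then show thesis
    by (intro that[of "N ^ Suc n"] ind one_le_power N) auto
qed

lemma c0_semigroup_continuous_on:
  fixes T :: "real \<Rightarrow> 'a::banach \<Rightarrow>\<^sub>L 'a"
  assumes T: "c0_semigroup T"
  shows "continuous_on {0..b} (\<lambda>t. T t x)"
  unfolding continuous_on_iff
proof (intro ballI allI impI)
  fix t e :: real assume t: "t \<in> {0..b}" and e: "0 < e"
  obtain M where M: "1 \<le> M" "\<And>t. 0 \<le> t \<Longrightarrow> t \<le> b \<Longrightarrow> norm (T t) \<le> M"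
    using c0_semigroup_bounded[OF T] by blast
  obtain d where d: "0 < d" "\<And>t. 0 \<le> t \<Longrightarrow> t < d \<Longrightarrow> norm (T t x - x) < e / M"
    using c0_semigroup_near_zero[OF T, of "e / M" x] M e by auto
  \<comment> \<open>Factoring out the earlier time \<open>s\<close> reduces continuity from either
    side to continuity of the orbit at 0; \<open>d\<close> does not depend on \<open>s\<close> or
    \<open>u\<close>.\<close>
  have close: "dist (T u x) (T s x) < e" if "s \<in> {0..b}" "s \<le> u" "u - s < d" for s u
  proof -
    have "T u x = T s (T (u - s) x)" using c0_semigroup_add[OF T, of s "u - s" x] that by simp
    then have "dist (T u x) (T s x) = norm (T s (T (u - s) x - x))"
      by (simp add: dist_norm blinfun.diff_right)
    also have "\<dots> \<le> norm (T s) * norm (T (u - s) x - x)" by (rule norm_blinfun)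
    also have "\<dots> \<le> M * norm (T (u - s) x - x)" using M that by (intro mult_right_mono) auto
    also have "\<dots> < M * (e / M)" using d(2)[of "u - s"] that M(1) by (intro mult_strict_left_mono) auto
    also have "\<dots> = e" using M(1) by simp
    finally show ?thesis .
  qed
  show "\<exists>d>0. \<forall>s\<in>{0..b}. dist s t < d \<longrightarrow> dist (T s x) (T t x) < e"
  proof (intro exI[of _ d] conjI ballI impI)
    fix s assume s: "s \<in> {0..b}" "dist s t < d"
    show "dist (T s x) (T t x) < e"
    proof (cases "t \<le> s")
      case True
      then show ?thesis using close[of t s] s t by (auto simp: dist_real_def)
    next
      case False
      then show ?thesis using close[of s t] s t by (auto simp: dist_real_def dist_commute)
    qed
  qed fact
qed

section \<open>Integrals of orbits and their relation to the generator\<close>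

definition orbit_integral :: "(real \<Rightarrow> 'a::banach \<Rightarrow>\<^sub>L 'a) \<Rightarrow> real \<Rightarrow> 'a \<Rightarrow> 'a" where
  "orbit_integral T \<tau> x = integral {0..\<tau>} (\<lambda>t. T t x)"

lemma c0_semigroup_integrable:
  fixes T :: "real \<Rightarrow> 'a::banach \<Rightarrow>\<^sub>L 'a"
  shows "c0_semigroup T \<Longrightarrow> (\<lambda>t. T t x) integrable_on {0..\<tau>}"
  by (intro integrable_continuous_real c0_semigroup_continuous_on)

lemma norm_orbit_integral_le:
  assumes T: "c0_semigroup T" and M: "\<And>t. 0 \<le> t \<Longrightarrow> t \<le> \<tau> \<Longrightarrow> norm (T t) \<le> M" and "0 \<le> \<tau>"
  shows "norm (orbit_integral T \<tau> x) \<le> \<tau> * M * norm x"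
proof -
  have "norm (T t x) \<le> M * norm x" if "t \<in> {0..\<tau>}" for t
    using norm_blinfun[of "T t" x] M[of t] that
    by (meson atLeastAtMost_iff mult_right_mono norm_ge_zero order_trans)
  then have "norm (orbit_integral T \<tau> x) \<le> M * norm x * (\<tau> - 0)"
    unfolding orbit_integral_def
    using \<open>0 \<le> \<tau>\<close> c0_semigroup_continuous_on[OF T] by (intro integral_bound) auto
  then show ?thesis by (simp add: mult.commute mult.left_commute)
qed

lemma bounded_linear_orbit_integral:
  assumes T: "c0_semigroup T"
  shows "bounded_linear (orbit_integral T \<tau>)"
proof (cases "0 \<le> \<tau>")
  case True
  obtain M where M: "\<And>t. 0 \<le> t \<Longrightarrow> t \<le> \<tau> \<Longrightarrow> norm (T t) \<le> M"
    using c0_semigroup_bounded[OF T] by blast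
  show ?thesis
  proof (rule bounded_linear_intro)
    show "norm (orbit_integral T \<tau> x) \<le> norm x * (\<tau> * M)" for x
      using norm_orbit_integral_le[OF T M True] by (simp add: mult.commute)
  qed (simp_all add: orbit_integral_def blinfun.add_right blinfun.scaleR_right
      integral_add[OF c0_semigroup_integrable[OF T] c0_semigroup_integrable[OF T]])
next
  case False
  \<comment> \<open>For negative \<open>\<tau>\<close> the interval is empty and the integral is
    0.\<close>
  then have "orbit_integral T \<tau> = (\<lambda>x. 0)" by (auto simp: orbit_integral_def fun_eq_iff)
  then show ?thesis by simp
qed

lemma orbit_integral_semigroup:
  assumes T: "c0_semigroup T" and "0 \<le> s"
  shows "T s (orbit_integral T \<tau> x) = orbit_integral T \<tau> (T s x)"
proof -
  have "T s (orbit_integral T \<tau> x) = integral {0..\<tau>} (\<lambda>t. T s (T t x))"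
    unfolding orbit_integral_def by (rule integral_blinfun_apply[symmetric])
      (rule c0_semigroup_integrable[OF T])
  also have "\<dots> = orbit_integral T \<tau> (T s x)"
    unfolding orbit_integral_def using c0_semigroup_commute[OF T] \<open>0 \<le> s\<close>
    by (intro integral_cong) auto
  finally show ?thesis .
qed

text \<open>One integral operator is bounded linear and so passes inside the other integral, where
  it commutes with each \<open>T t\<close>. This replaces an exchange of the order of
  integration.\<close>

lemma orbit_integral_commute:
  assumes T: "c0_semigroup T"
  shows "orbit_integral T \<sigma> (orbit_integral T \<tau> x) = orbit_integral T \<tau> (orbit_integral T \<sigma> x)"
proof -
  have "orbit_integral T \<sigma> (orbit_integral T \<tau> x) = integral {0..\<tau>} (orbit_integral T \<sigma> \<circ> (\<lambda>t. T t x))"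
    unfolding orbit_integral_def[of T \<tau>]
    using integral_linear[OF c0_semigroup_integrable[OF T] bounded_linear_orbit_integral[OF T]]
    by simp
  also have "\<dots> = orbit_integral T \<tau> (orbit_integral T \<sigma> x)"
    unfolding orbit_integral_def[of T \<tau>] using orbit_integral_semigroup[OF T]
    by (intro integral_cong) auto
  finally show ?thesis .
qed

lemma orbit_integral_right_derivative:
  assumes T: "c0_semigroup T" and "0 \<le> \<tau>"
  shows "((\<lambda>s. (1 / s) *\<^sub>R (orbit_integral T (\<tau> + s) x - orbit_integral T \<tau> x)) \<longlongrightarrow> T \<tau> x) (at_right 0)"
proof -
  let ?F = "\<lambda>u. orbit_integral T u x"
  \<comment> \<open>The interval reaches to \<open>\<tau> + 1\<close> to leave room on the right of
    \<open>\<tau>\<close>; the derivative is then restricted to that side.\<close>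
  have "(?F has_vector_derivative T \<tau> x) (at \<tau> within {0..\<tau> + 1})"
    unfolding orbit_integral_def using \<open>0 \<le> \<tau>\<close>
    by (intro integral_has_vector_derivative c0_semigroup_continuous_on[OF T]) auto
  then have "(?F has_vector_derivative T \<tau> x) (at \<tau> within {\<tau>..\<tau> + 1})"
    by (rule has_vector_derivative_within_subset) (use \<open>0 \<le> \<tau>\<close> in auto)
  then have "(?F has_vector_derivative T \<tau> x) (at_right \<tau>)"
    by (simp add: at_within_Icc_at_right)
  then have "((\<lambda>u. (1 / norm (u - \<tau>)) *\<^sub>R (?F u - (?F \<tau> + (u - \<tau>) *\<^sub>R T \<tau> x))) \<longlongrightarrow> 0) (at_right \<tau>)"
    unfolding has_vector_derivative_def has_derivative_within by blast
  then have "((\<lambda>s. (1 / norm s) *\<^sub>R (?F (s + \<tau>) - (?F \<tau> + s *\<^sub>R T \<tau> x))) \<longlongrightarrow> 0) (at_right 0)"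
    unfolding filterlim_at_right_to_0[of _ _ \<tau>] by simp
  then have "((\<lambda>s. (1 / norm s) *\<^sub>R (?F (s + \<tau>) - (?F \<tau> + s *\<^sub>R T \<tau> x)) + T \<tau> x) \<longlongrightarrow> 0 + T \<tau> x) (at_right 0)"
    by (intro tendsto_add tendsto_const)
  moreover have "\<forall>\<^sub>F s in at_right 0. (1 / norm s) *\<^sub>R (?F (s + \<tau>) - (?F \<tau> + s *\<^sub>R T \<tau> x)) + T \<tau> x
      = (1 / s) *\<^sub>R (?F (\<tau> + s) - ?F \<tau>)"
    using eventually_at_right_less[of 0]
    by eventually_elim (simp add: scaleR_diff_right scaleR_add_right add.commute)
  ultimately show ?thesis by (simp add: tendsto_cong)
qed

lemma orbit_integral_average_tendsto:
  assumes T: "c0_semigroup T"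
  shows "((\<lambda>s. (1 / s) *\<^sub>R orbit_integral T s x) \<longlongrightarrow> x) (at_right 0)"
  using orbit_integral_right_derivative[OF T, of 0 x] by (simp add: c0_semigroup_zero[OF T] orbit_integral_def)

text \<open>Shifting the integration variable turns \<open>T s (?F \<tau>) - ?F \<tau>\<close> into
  \<open>(?F (\<tau> + s) - ?F \<tau>) - ?F s\<close>. After division by \<open>s\<close> the two
  parts tend to \<open>T \<tau> x\<close> and \<open>x\<close>.\<close>

lemma orbit_integral_in_generator:
  assumes T: "c0_semigroup T" and "0 \<le> \<tau>"
  shows "(orbit_integral T \<tau> x, T \<tau> x - x) \<in> generator T"
proof -
  let ?F = "\<lambda>u. orbit_integral T u x"
  have "((\<lambda>s. (1 / s) *\<^sub>R (?F (\<tau> + s) - ?F \<tau>) - (1 / s) *\<^sub>R ?F s) \<longlongrightarrow> T \<tau> x - x) (at_right 0)"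
    by (intro tendsto_diff orbit_integral_right_derivative orbit_integral_average_tendsto T \<open>0 \<le> \<tau>\<close>)
  moreover have "(1 / s) *\<^sub>R (?F (\<tau> + s) - ?F \<tau>) - (1 / s) *\<^sub>R ?F s
      = (1 / s) *\<^sub>R (T s (?F \<tau>) - ?F \<tau>)" if "0 < s" for s
  proof -
    have "T s (?F \<tau>) = integral {0..\<tau>} (\<lambda>t. T s (T t x))"
      unfolding orbit_integral_def by (rule integral_blinfun_apply[symmetric])
        (rule c0_semigroup_integrable[OF T])
    also have "\<dots> = integral {0..\<tau>} ((\<lambda>t. T t x) \<circ> (+) s)"
      using c0_semigroup_add[OF T] that by (intro integral_cong) auto
    also have "\<dots> = integral {s..\<tau> + s} (\<lambda>t. T t x)"
      by (simp only: integral_shift_Icc_real add_0)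
    also have "\<dots> = ?F (\<tau> + s) - ?F s"
      using Henstock_Kurzweil_Integration.integral_combine[of 0 s "\<tau> + s" "\<lambda>t. T t x"] that \<open>0 \<le> \<tau>\<close>
        c0_semigroup_integrable[OF T]
      by (simp add: orbit_integral_def algebra_simps)
    finally show ?thesis by (simp add: scaleR_diff_right diff_right_commute)
  qed
  then have "\<forall>\<^sub>F s in at_right 0. (1 / s) *\<^sub>R (?F (\<tau> + s) - ?F \<tau>) - (1 / s) *\<^sub>R ?F s
      = (1 / s) *\<^sub>R (T s (?F \<tau>) - ?F \<tau>)"
    using eventually_at_right_less[of "0::real"] by (auto elim: eventually_mono)
  ultimately show ?thesis by (simp add: generator_def tendsto_cong)
qed

text \<open>The integral operator is continuous and commutes with \<open>T s\<close>. It therefore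
  maps the difference quotients of \<open>x\<close> to those of
  \<open>orbit_integral T \<tau> x\<close>, whose limit is known from
  \<open>orbit_integral_in_generator\<close>.\<close>

lemma orbit_integral_of_generator:
  assumes T: "c0_semigroup T" and "0 \<le> \<tau>" and xy: "(x, y) \<in> generator T"
  shows "orbit_integral T \<tau> y = T \<tau> x - x"
proof (rule tendsto_unique)
  interpret J: bounded_linear "orbit_integral T \<tau>" by (rule bounded_linear_orbit_integral[OF T])
  show "((\<lambda>s. orbit_integral T \<tau> ((1 / s) *\<^sub>R (T s x - x))) \<longlongrightarrow> orbit_integral T \<tau> y) (at_right 0)"
    using xy by (intro J.tendsto) (simp add: generator_def)
  have "((\<lambda>s. (1 / s) *\<^sub>R (T s (orbit_integral T \<tau> x) - orbit_integral T \<tau> x)) \<longlongrightarrow> T \<tau> x - x) (at_right 0)"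
    using orbit_integral_in_generator[OF T \<open>0 \<le> \<tau>\<close>] by (simp add: generator_def)
  moreover have "\<forall>\<^sub>F s in at_right 0. (1 / s) *\<^sub>R (T s (orbit_integral T \<tau> x) - orbit_integral T \<tau> x)
      = orbit_integral T \<tau> ((1 / s) *\<^sub>R (T s x - x))"
    using eventually_at_right_less[of 0]
    by eventually_elim (simp add: J.scaleR J.diff orbit_integral_semigroup[OF T])
  ultimately show "((\<lambda>s. orbit_integral T \<tau> ((1 / s) *\<^sub>R (T s x - x))) \<longlongrightarrow> T \<tau> x - x) (at_right 0)"
    by (simp add: tendsto_cong)
qed simp

lemma orbit_integral_nonneg:
  assumes T: "c0_semigroup T" "positive_semigroup T" and x: "0 \<le> x"
  shows "0 \<le> orbit_integral T \<tau> x"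
  using integrable_integral[OF c0_semigroup_integrable[OF T(1)]]
  unfolding orbit_integral_def
  by (rule has_integral_nonneg_banach_lattice) (use T(2) x in \<open>auto simp: positive_semigroup_def\<close>)

section \<open>Algebra of the generator and exponential rescaling\<close>

lemma generator_add:
  assumes "(x, y) \<in> generator T" "(x', y') \<in> generator T"
  shows "(x + x', y + y') \<in> generator T"
  using tendsto_add[of _ y _ _ y'] assms
  by (fastforce simp: generator_def blinfun.add_right algebra_simps)

lemma generator_scaleR:
  assumes "(x, y) \<in> generator T"
  shows "(r *\<^sub>R x, r *\<^sub>R y) \<in> generator T"
  using tendsto_scaleR[OF tendsto_const[of r]] assms
  by (fastforce simp: generator_def blinfun.scaleR_right algebra_simps)

lemma generator_semigroup:
  assumes T: "c0_semigroup T" and "0 \<le> r" and xy: "(x, y) \<in> generator T"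
  shows "(T r x, T r y) \<in> generator T"
proof -
  have "((\<lambda>s. T r ((1 / s) *\<^sub>R (T s x - x))) \<longlongrightarrow> T r y) (at_right 0)"
    using xy by (intro blinfun.tendsto tendsto_const) (simp add: generator_def)
  moreover have "\<forall>\<^sub>F s in at_right 0. T r ((1 / s) *\<^sub>R (T s x - x)) = (1 / s) *\<^sub>R (T s (T r x) - T r x)"
    using eventually_at_right_less[of 0]
    by eventually_elim
      (simp add: blinfun.scaleR_right blinfun.diff_right c0_semigroup_commute[OF T \<open>0 \<le> r\<close>])
  ultimately show ?thesis by (simp add: generator_def tendsto_cong)
qed

text \<open>This is the semigroup generated by \<open>A - \<beta> I\<close> when \<open>T\<close>
  has generator \<open>A\<close>. The domain of the generator and positivity are preserved, while
  the operator at time 1 becomes small for large \<open>\<beta>\<close>.\<close>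

definition rescaled :: "real \<Rightarrow> (real \<Rightarrow> 'a::real_normed_vector \<Rightarrow>\<^sub>L 'a) \<Rightarrow> real \<Rightarrow> 'a \<Rightarrow>\<^sub>L 'a" where
  "rescaled \<beta> T t = exp (- \<beta> * t) *\<^sub>R T t"

lemma rescaled_tendsto_1: "((\<lambda>t::real. exp (- \<beta> * t)) \<longlongrightarrow> 1) (at_right 0)"
  by (rule tendsto_eq_intros refl | simp)+

lemma c0_semigroup_rescaled:
  assumes T: "c0_semigroup T"
  shows "c0_semigroup (rescaled \<beta> T)"
  unfolding c0_semigroup_def
proof (intro conjI allI impI)
  show "rescaled \<beta> T 0 = id_blinfun" using T by (simp add: rescaled_def c0_semigroup_def)
  fix s t :: real assume "0 \<le> s" "0 \<le> t"
  then show "rescaled \<beta> T (s + t) = rescaled \<beta> T s o\<^sub>L rescaled \<beta> T t"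
    by (intro blinfun_eqI)
      (simp add: rescaled_def c0_semigroup_add[OF T] blinfun.scaleR_left blinfun.scaleR_right
        mult_exp_exp algebra_simps)
next
  fix x
  have "((\<lambda>t. exp (- \<beta> * t) *\<^sub>R T t x) \<longlongrightarrow> 1 *\<^sub>R x) (at_right 0)"
    by (intro tendsto_scaleR rescaled_tendsto_1 c0_semigroup_tendsto T)
  then show "((\<lambda>t. rescaled \<beta> T t x) \<longlongrightarrow> x) (at_right 0)"
    by (simp add: rescaled_def blinfun.scaleR_left)
qed

lemma positive_semigroup_rescaled: "positive_semigroup T \<Longrightarrow> positive_semigroup (rescaled \<beta> T)"
  by (auto simp: positive_semigroup_def rescaled_def blinfun.scaleR_left intro: scaleR_nonneg_nonneg)

lemma generator_rescaledI:
  assumes "(x, y) \<in> generator T"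
  shows "(x, y - \<beta> *\<^sub>R x) \<in> generator (rescaled \<beta> T)"
proof -
  have "((\<lambda>t. exp (- \<beta> * t)) has_real_derivative - \<beta>) (at 0)"
    by (auto intro!: derivative_eq_intros)
  then have "((\<lambda>t. exp (- \<beta> * t)) has_real_derivative - \<beta>) (at_right 0)"
    by (rule DERIV_subset) simp
  then have "((\<lambda>t. (exp (- \<beta> * t) - 1) / t) \<longlongrightarrow> - \<beta>) (at_right 0)"
    by (simp add: has_field_derivative_iff)
  \<comment> \<open>Product rule: the difference quotient of the rescaled orbit splits into that of
    \<open>T\<close>, weighted by the exponential, and that of the exponential, applied to
    \<open>x\<close>.\<close>
  then have "((\<lambda>t. exp (- \<beta> * t) *\<^sub>R ((1 / t) *\<^sub>R (T t x - x)) + ((exp (- \<beta> * t) - 1) / t) *\<^sub>R x)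
      \<longlongrightarrow> 1 *\<^sub>R y + (- \<beta>) *\<^sub>R x) (at_right 0)"
    using assms by (intro tendsto_intros rescaled_tendsto_1) (simp_all add: generator_def)
  then show ?thesis
    by (simp add: generator_def rescaled_def blinfun.scaleR_left algebra_simps diff_divide_distrib)
qed

lemma generator_rescaledD:
  assumes "(x, y) \<in> generator (rescaled \<beta> T)"
  shows "(x, y + \<beta> *\<^sub>R x) \<in> generator T"
proof -
  \<comment> \<open>Rescaling by \<open>- \<beta>\<close> undoes the rescaling by
    \<open>\<beta>\<close>, so the other inclusion is an instance of
    \<open>generator_rescaledI\<close>.\<close>
  have "rescaled (- \<beta>) (rescaled \<beta> T) = T"
    by (rule ext) (simp add: rescaled_def flip: exp_add)
  then show ?thesis using generator_rescaledI[OF assms, of "- \<beta>"] by simp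
qed

lemma Domain_generator_rescaled: "Domain (generator (rescaled \<beta> T)) = Domain (generator T)"
  by (auto simp: Domain_iff dest: generator_rescaledI[of _ _ _ \<beta>] generator_rescaledD)

lemma graph_bounded_linear_bound:
  assumes "graph_bounded_linear A C"
  obtains K where "\<And>x y. (x, y) \<in> A \<Longrightarrow> norm (C x) \<le> K * (norm x + norm y)"
proof -
  obtain K where "\<forall>(x, y)\<in>A. norm (C x) \<le> K * (norm x + norm y)"
    using assms unfolding graph_bounded_linear_def by blast
  then show thesis by (intro that[of K]) auto
qed

lemma graph_bounded_linear_rescaled:
  assumes "graph_bounded_linear (generator T) C"
  shows "graph_bounded_linear (generator (rescaled \<beta> T)) C"
proof -
  obtain K where K: "\<And>x y. (x, y) \<in> generator T \<Longrightarrow> norm (C x) \<le> K * (norm x + norm y)"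
    using graph_bounded_linear_bound[OF assms] by blast
  have "norm (C x) \<le> \<bar>K\<bar> * (1 + \<bar>\<beta>\<bar>) * (norm x + norm y)"
    if "(x, y) \<in> generator (rescaled \<beta> T)" for x y
  proof -
    have "norm (y + \<beta> *\<^sub>R x) \<le> norm y + \<bar>\<beta>\<bar> * norm x"
      using norm_triangle_ineq[of y "\<beta> *\<^sub>R x"] by simp
    moreover have "0 \<le> \<bar>\<beta>\<bar> * norm y" by simp
    ultimately have "norm x + norm (y + \<beta> *\<^sub>R x) \<le> (1 + \<bar>\<beta>\<bar>) * (norm x + norm y)"
      unfolding distrib_left distrib_right by linarith
    then have "\<bar>K\<bar> * (norm x + norm (y + \<beta> *\<^sub>R x)) \<le> \<bar>K\<bar> * ((1 + \<bar>\<beta>\<bar>) * (norm x + norm y))"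
      by (rule mult_left_mono) simp
    moreover have "K * (norm x + norm (y + \<beta> *\<^sub>R x)) \<le> \<bar>K\<bar> * (norm x + norm (y + \<beta> *\<^sub>R x))"
      by (rule mult_right_mono) auto
    ultimately show ?thesis using K[OF generator_rescaledD[OF that]] by (simp add: mult.assoc)
  qed
  then show ?thesis
    using assms unfolding graph_bounded_linear_def Domain_generator_rescaled by fast
qed

subsection \<open>Inverse estimate and boundedness of positive observation operators\<close>

text \<open>The real resolvent is the real part of the complex one restricted to real vectors
  \<open>(v, 0)\<close>. The hypothesis \<open>zero\<close> allows \<open>(u, 0)\<close> to be
  tested in the left inverse, which gives uniqueness.\<close>

lemma resolvent_bounded_linear:
  fixes B :: "('a::real_normed_vector, 'a) operator_graph"
  assumes \<mu>: "complex_of_real \<mu> \<in> resolvent_set B" and zero: "(0, 0) \<in> B"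
  shows "bounded_linear (resolvent \<mu> B)"
    and "\<And>u w. (u, w) \<in> B \<Longrightarrow> resolvent \<mu> B (\<mu> *\<^sub>R u - w) = u"
proof -
  obtain R where R: "bounded_linear R"
    and left: "\<And>z w. (z, w) \<in> complexification B \<Longrightarrow> R (complex_scale (of_real \<mu>) z - w) = z"
    and right: "\<And>v. (R v, complex_scale (of_real \<mu>) (R v) - v) \<in> complexification B"
    using \<mu> unfolding resolvent_set_def by blast
  have inv: "u = fst (R (v, 0))" if "(u, \<mu> *\<^sub>R u - v) \<in> B" for u v
    using left[of "(u, 0)" "(\<mu> *\<^sub>R u - v, 0)"] that zero
    by (simp add: complexification_def complex_scale_def)
  have "(fst (R (v, 0)), \<mu> *\<^sub>R fst (R (v, 0)) - v) \<in> B" for v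
    using right[of "(v, 0)"]
    by (auto simp: complexification_def complex_scale_def split: prod.splits)
  then have res: "resolvent \<mu> B v = fst (R (v, 0))" for v
    unfolding resolvent_def using inv by (intro the_equality)
  have "bounded_linear (\<lambda>v. fst (R (v, 0)))"
    by (intro bounded_linear_compose[OF bounded_linear_fst] bounded_linear_compose[OF R]
        bounded_linear_Pair bounded_linear_ident bounded_linear_zero)
  then show "bounded_linear (resolvent \<mu> B)" by (simp add: res[abs_def])
  show "resolvent \<mu> B (\<mu> *\<^sub>R u - w) = u" if "(u, w) \<in> B" for u w
    using inv[of u "\<mu> *\<^sub>R u - w"] that by (simp add: res)
qed

lemma in_resolvent_set_if_gt_spectral_bound:
  assumes "spectral_bound B < ereal \<mu>"
  shows "complex_of_real \<mu> \<in> resolvent_set B"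
proof (rule ccontr)
  assume "complex_of_real \<mu> \<notin> resolvent_set B"
  then have "ereal (Re (complex_of_real \<mu>)) \<le> spectral_bound B"
    unfolding spectral_bound_def spectrum_def by (intro SUP_upper) simp
  with assms show False by simp
qed

text \<open>With \<open>S = rescaled \<beta> T\<close> and \<open>W\<close> the integral of its orbits over \<open>[0, 1]\<close>, the functional
  \<open>\<phi> \<circ> W\<close> is an approximation of \<open>R(\<beta>, A\<^sup>*) \<phi>\<close>: one has
  \<open>(\<beta> - A\<^sup>*) (\<phi> \<circ> W) = \<phi> - \<phi> \<circ> S(1)\<close>, and \<open>S(1)\<close> is small for large \<open>\<beta>\<close>.\<close>

lemma inverse_estimate_orbit_integral:
  fixes T :: "real \<Rightarrow> 'a::banach_lattice \<Rightarrow>\<^sub>L 'a"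
  assumes T: "c0_semigroup T" and "0 < c"
    and sb: "spectral_bound (adjoint_graph (generator T)) < ereal \<mu>"
    and est: "\<And>\<phi>. \<phi> \<in> dual_cone \<Longrightarrow> c * norm \<phi> \<le> norm (resolvent \<mu> (adjoint_graph (generator T)) \<phi>)"
  obtains \<beta> K where "\<And>\<phi>. \<phi> \<in> dual_cone \<Longrightarrow>
    norm \<phi> \<le> K * norm (\<phi> o\<^sub>L Blinfun (orbit_integral (rescaled \<beta> T) 1))"
proof -
  let ?A = "generator T"
  let ?R = "resolvent \<mu> (adjoint_graph ?A)"
  have "(0, 0) \<in> adjoint_graph ?A" by (simp add: adjoint_graph_def)
  note R = resolvent_bounded_linear[OF in_resolvent_set_if_gt_spectral_bound[OF sb] this]
  interpret R: bounded_linear ?R by (rule R(1))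
  obtain B where B: "0 < B" "\<And>\<phi>. norm (?R \<phi>) \<le> norm \<phi> * B" using R.pos_bounded by blast
  \<comment> \<open>\<open>\<beta>\<close> is chosen so large that the error term
    \<open>?R (\<phi> o\<^sub>L S 1)\<close> has norm at most \<open>c / 2 * norm \<phi>\<close>;
    half of the lower estimate then survives.\<close>
  have "((\<lambda>\<beta>. exp (- \<beta>) * (norm (T 1) * B)) \<longlongrightarrow> 0 * (norm (T 1) * B)) at_top"
    by (intro tendsto_mult tendsto_const filterlim_compose[OF exp_at_bot] filterlim_uminus_at_bot_at_top)
  then have "\<forall>\<^sub>F \<beta> in at_top. exp (- \<beta>) * (norm (T 1) * B) < c / 2"
    using \<open>0 < c\<close> by (intro order_tendstoD) auto
  then obtain \<beta> where \<beta>: "exp (- \<beta>) * (norm (T 1) * B) < c / 2"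
    using eventually_happens trivial_limit_at_top_linorder by blast
  define S where "S = rescaled \<beta> T"
  define W where "W = Blinfun (orbit_integral S 1)"
  have S: "c0_semigroup S" unfolding S_def by (rule c0_semigroup_rescaled[OF T])
  have W: "W x = orbit_integral S 1 x" for x
    unfolding W_def by (simp add: bounded_linear_Blinfun_apply[OF bounded_linear_orbit_integral[OF S]])
  define K where "K = 2 / c * (1 + \<bar>\<beta> - \<mu>\<bar> * B)"
  have "norm \<phi> \<le> K * norm (\<phi> o\<^sub>L W)" if \<phi>: "\<phi> \<in> dual_cone" for \<phi>
  proof -
    let ?\<chi> = "\<phi> o\<^sub>L W" and ?\<omega> = "\<phi> o\<^sub>L S 1"
    have "\<phi> (W y) = (?\<omega> - \<phi> + \<beta> *\<^sub>R ?\<chi>) x" if "(x, y) \<in> ?A" for x y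
    proof -
      have "(x, y - \<beta> *\<^sub>R x) \<in> generator S" unfolding S_def by (rule generator_rescaledI[OF that])
      then have "W (y - \<beta> *\<^sub>R x) = S 1 x - x"
        unfolding W by (intro orbit_integral_of_generator[OF S]) auto
      then have "W y = S 1 x - x + \<beta> *\<^sub>R W x"
        by (simp add: blinfun.diff_right blinfun.scaleR_right algebra_simps)
      then show ?thesis
        by (simp add: blinfun.diff_left blinfun.add_left blinfun.scaleR_left
            blinfun.add_right blinfun.diff_right blinfun.scaleR_right)
    qed
    then have "(?\<chi>, ?\<omega> - \<phi> + \<beta> *\<^sub>R ?\<chi>) \<in> adjoint_graph ?A" by (auto simp: adjoint_graph_def)
    from R(2)[OF this] have "?\<chi> = ?R ((\<mu> - \<beta>) *\<^sub>R ?\<chi> - ?\<omega> + \<phi>)" by (simp add: algebra_simps)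
    then have "?R \<phi> = ?\<chi> + (\<beta> - \<mu>) *\<^sub>R ?R ?\<chi> + ?R ?\<omega>"
      by (simp add: R.add R.diff R.scaleR algebra_simps)
    then have "norm (?R \<phi>) \<le> norm ?\<chi> + \<bar>\<beta> - \<mu>\<bar> * norm (?R ?\<chi>) + norm (?R ?\<omega>)"
      by (metis norm_triangle_le norm_triangle_ineq add_mono order_refl norm_scaleR)
    also have "\<dots> \<le> norm ?\<chi> + \<bar>\<beta> - \<mu>\<bar> * (norm ?\<chi> * B) + norm ?\<omega> * B"
      by (intro add_mono mult_left_mono B(2)) auto
    also have "norm ?\<omega> * B \<le> norm \<phi> * (exp (- \<beta>) * norm (T 1)) * B"
      using norm_blinfun_compose[of \<phi> "S 1"] B(1)
      by (intro mult_right_mono) (auto simp: S_def rescaled_def)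
    also have "\<dots> = norm \<phi> * (exp (- \<beta>) * (norm (T 1) * B))" by simp
    also have "\<dots> \<le> norm \<phi> * (c / 2)" using \<beta> by (intro mult_left_mono) auto
    finally have "c * norm \<phi> \<le> norm ?\<chi> + \<bar>\<beta> - \<mu>\<bar> * (norm ?\<chi> * B) + norm \<phi> * (c / 2)"
      using est[OF \<phi>] by simp
    then have "norm \<phi> * (c / 2) \<le> (1 + \<bar>\<beta> - \<mu>\<bar> * B) * norm ?\<chi>" by (simp add: algebra_simps)
    then show ?thesis using \<open>0 < c\<close> by (simp add: K_def field_simps)
  qed
  then show thesis unfolding W_def S_def by (rule that)
qed

lemma norm_le_if_positive_functionals_le:
  fixes z :: "'a::banach_lattice"
  assumes "\<And>f::'a \<Rightarrow>\<^sub>L real. f \<in> dual_cone \<Longrightarrow> norm f \<le> 1 \<Longrightarrow> \<bar>f z\<bar> \<le> m"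
  shows "norm z \<le> 2 * m"
proof -
  obtain f :: "'a \<Rightarrow>\<^sub>L real" where f: "f \<in> dual_cone" "norm f \<le> 1" "f z = norm (sup z 0)"
    by (rule positive_norming_functional)
  obtain g :: "'a \<Rightarrow>\<^sub>L real" where g: "g \<in> dual_cone" "norm g \<le> 1" "g (- z) = norm (sup (- z) 0)"
    by (rule positive_norming_functional)
  \<comment> \<open>The factor 2 arises because the positive and negative parts of \<open>z\<close>
    are normed by two different functionals.\<close>
  have "norm z \<le> norm (sup z 0) + norm (sup (- z) 0)"
    using norm_triangle_ineq4[of "sup z 0" "sup (- z) 0"] by (simp add: sup_zero_diff)
  also have "\<dots> = f z + g (- z)" using f(3) g(3) by simp
  also have "\<dots> \<le> m + m"
    using assms[OF f(1,2)] assms[OF g(1,2)] by (intro add_mono) (auto simp: blinfun.minus_right)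
  finally show ?thesis by simp
qed

section \<open>Boundedness of positive observation operators in the norm of the state space\<close>

lemma positive_observation_bounded:
  fixes S :: "real \<Rightarrow> 'a::banach_lattice \<Rightarrow>\<^sub>L 'a" and C :: "'a \<Rightarrow> 'b::banach_lattice"
  assumes S: "c0_semigroup S" "positive_semigroup S"
    and est: "\<And>\<phi>. \<phi> \<in> dual_cone \<Longrightarrow> norm \<phi> \<le> K * norm (\<phi> o\<^sub>L Blinfun (orbit_integral S 1))"
    and C: "graph_bounded_linear (generator S) C" "positive_on_domain (generator S) C"
  obtains L where "\<And>x. x \<in> Domain (generator S) \<Longrightarrow> norm (C x) \<le> L * norm x"
proof -
  let ?G = "generator S"
  obtain M where M: "1 \<le> M" "\<And>t. 0 \<le> t \<Longrightarrow> t \<le> 1 \<Longrightarrow> norm (S t) \<le> M"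
    using c0_semigroup_bounded[OF S(1)] by blast
  obtain k0 where k0: "\<And>x y. (x, y) \<in> ?G \<Longrightarrow> norm (C x) \<le> k0 * (norm x + norm y)"
    using graph_bounded_linear_bound[OF C(1)] by blast
  define k where "k = \<bar>k0\<bar>"
  have "0 \<le> k" by (simp add: k_def)
  have k: "norm (C x) \<le> k * (norm x + norm y)" if "(x, y) \<in> ?G" for x y
    using k0[OF that] mult_right_mono[OF abs_ge_self[of k0], of "norm x + norm y"] by (simp add: k_def)
  have C_add: "C (x + x') = C x + C x'" if "x \<in> Domain ?G" "x' \<in> Domain ?G" for x x'
    using C(1) that by (auto simp: graph_bounded_linear_def)
  have C_scale: "C (r *\<^sub>R x) = r *\<^sub>R C x" if "x \<in> Domain ?G" for r x
    using C(1) that by (auto simp: graph_bounded_linear_def)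
  define W where "W = Blinfun (orbit_integral S 1)"
  have W: "W x = orbit_integral S 1 x" for x
    unfolding W_def by (simp add: bounded_linear_Blinfun_apply[OF bounded_linear_orbit_integral[OF S(1)]])
  have graph_W: "(W x, S 1 x - x) \<in> ?G" for x
    unfolding W by (rule orbit_integral_in_generator[OF S(1)]) simp
  \<comment> \<open>The constant bounds the graph norm of \<open>W x\<close>: \<open>M\<close> for
    \<open>W x\<close> itself and \<open>M + 1\<close> for its image \<open>S 1 x - x\<close> under
    the generator.\<close>
  have CW: "norm (C (W x)) \<le> k * (2 * M + 1) * norm x" for x
  proof -
    have "norm (W x) \<le> M * norm x" using norm_orbit_integral_le[OF S(1) M(2), of 1 x] by (simp add: W)
    moreover have "norm (S 1 x - x) \<le> M * norm x + norm x"
      using norm_triangle_ineq4[of "S 1 x" x] norm_blinfun[of "S 1" x]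
        mult_right_mono[OF M(2)[of 1], of "norm x"] by simp
    ultimately have "norm (W x) + norm (S 1 x - x) \<le> (2 * M + 1) * norm x" by (simp add: algebra_simps)
    then have "k * (norm (W x) + norm (S 1 x - x)) \<le> k * ((2 * M + 1) * norm x)"
      using \<open>0 \<le> k\<close> by (rule mult_left_mono)
    with k[OF graph_W, of x] show ?thesis by (simp add: mult.assoc)
  qed
  \<comment> \<open>The averages map into the domain, preserve positivity and converge strongly to
    the identity, so \<open>C\<close> may be composed with them on the whole space.\<close>
  define V where "V h x = (1 / h) *\<^sub>R orbit_integral S h x" for h x
  have blV: "bounded_linear (V h)" for h
    unfolding V_def by (intro bounded_linear_const_scaleR bounded_linear_orbit_integral S(1))
  have graph_V: "(V h x, (1 / h) *\<^sub>R (S h x - x)) \<in> ?G" if "0 \<le> h" for h x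
    unfolding V_def by (intro generator_scaleR orbit_integral_in_generator S(1) that)
  have dom_V: "V h x \<in> Domain ?G" if "0 \<le> h" for h x using graph_V[OF that] by blast
  have normV: "norm (V h x) \<le> M * norm x" if h: "0 < h" "h \<le> 1" for h x
  proof -
    have "norm (orbit_integral S h x) \<le> h * M * norm x"
      using h by (intro norm_orbit_integral_le[OF S(1)] M(2)) auto
    then show ?thesis using h by (simp add: V_def field_simps)
  qed
  \<comment> \<open>The factors come from the inverse estimate, from the bound on \<open>C\<close>
    after \<open>W\<close>, and from the bound on \<open>V h\<close>; none depends on
    \<open>h\<close>.\<close>
  define L where "L = \<bar>K\<bar> * (k * (2 * M + 1) * M)"
  have CV: "norm (C (V h x)) \<le> 2 * (L * norm x)" if h: "0 < h" "h \<le> 1" for h x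
  proof (rule norm_le_if_positive_functionals_le)
    fix f :: "'b \<Rightarrow>\<^sub>L real" assume f: "f \<in> dual_cone" "norm f \<le> 1"
    interpret V: bounded_linear "V h" by (rule blV)
    have f_le: "norm (f z) \<le> norm z" for z
      using norm_blinfun[of f z] mult_right_mono[OF f(2), of "norm z"] by simp
    \<comment> \<open>This bound blows up as \<open>h\<close> tends to 0. It serves only to make
      \<open>f\<close>, \<open>C\<close> and \<open>V h\<close> compose to a bounded
      functional.\<close>
    have "norm (C (V h x)) \<le> norm x * (k * (M + \<bar>1 / h\<bar> * (M + 1)))" for x
    proof -
      have "norm (S h x - x) \<le> (M + 1) * norm x"
        using norm_triangle_ineq4[of "S h x" x] norm_blinfun[of "S h" x]
          mult_right_mono[OF M(2)[of h], of "norm x"] h by (simp add: algebra_simps)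
      then have "norm (V h x) + norm ((1 / h) *\<^sub>R (S h x - x)) \<le> M * norm x + \<bar>1 / h\<bar> * ((M + 1) * norm x)"
        using normV[OF h, of x] by (simp only: norm_scaleR) (intro add_mono mult_left_mono, auto)
      then have "k * (norm (V h x) + norm ((1 / h) *\<^sub>R (S h x - x)))
          \<le> k * (M * norm x + \<bar>1 / h\<bar> * ((M + 1) * norm x))"
        using \<open>0 \<le> k\<close> by (rule mult_left_mono)
      then show ?thesis using k[OF graph_V, of h x] h by (simp add: algebra_simps add_divide_distrib)
    qed
    then have "bounded_linear (\<lambda>x. C (V h x))"
      using h by (intro bounded_linear_intro) (simp_all add: V.add V.scaleR C_add C_scale dom_V)
    then have bl: "bounded_linear (\<lambda>x. f (C (V h x)))"
      by (rule bounded_linear_compose[OF blinfun.bounded_linear_right])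
    define \<phi> where "\<phi> = Blinfun (\<lambda>x. f (C (V h x)))"
    have \<phi>: "\<phi> x = f (C (V h x))" for x
      unfolding \<phi>_def by (simp add: bounded_linear_Blinfun_apply[OF bl])
    have "\<phi> \<in> dual_cone"
      unfolding dual_cone_def
    proof safe
      fix x :: 'a assume "0 \<le> x"
      then have "0 \<le> V h x"
        using h unfolding V_def by (intro scaleR_nonneg_nonneg orbit_integral_nonneg S) auto
      then have "0 \<le> C (V h x)" using C(2) dom_V[of h x] h by (simp add: positive_on_domain_def)
      then show "0 \<le> \<phi> x" using f(1) by (simp add: \<phi> dual_cone_def)
    qed
    then have "norm \<phi> \<le> \<bar>K\<bar> * norm (\<phi> o\<^sub>L W)"
      using est[of \<phi>] mult_right_mono[OF abs_ge_self[of K], of "norm (\<phi> o\<^sub>L W)"] by (simp add: W_def)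
    also have "norm (\<phi> o\<^sub>L W) \<le> k * (2 * M + 1) * M"
    proof (rule norm_blinfun_bound)
      show "0 \<le> k * (2 * M + 1) * M" using \<open>0 \<le> k\<close> M(1) by simp
      fix x
      \<comment> \<open>Commuting puts \<open>C\<close> next to \<open>W\<close>, where
        \<open>CW\<close> applies, so that \<open>V h\<close> contributes only the factor
        \<open>M\<close> in place of one of order \<open>1 / h\<close>.\<close>
      have "V h (W x) = W (V h x)"
        unfolding W V_def
        by (simp add: orbit_integral_commute[OF S(1), of h 1]
            linear_scale[OF bounded_linear.linear[OF bounded_linear_orbit_integral[OF S(1)]]])
      then have "norm ((\<phi> o\<^sub>L W) x) \<le> norm (C (W (V h x)))" using f_le by (simp add: \<phi>)
      also have "\<dots> \<le> k * (2 * M + 1) * norm (V h x)" by (rule CW)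
      also have "\<dots> \<le> k * (2 * M + 1) * (M * norm x)"
        using normV[OF h] \<open>0 \<le> k\<close> M(1) by (intro mult_left_mono) auto
      finally show "norm ((\<phi> o\<^sub>L W) x) \<le> k * (2 * M + 1) * M * norm x" by (simp add: mult.assoc)
    qed
    finally have "norm \<phi> \<le> L" by (simp add: L_def mult_left_mono)
    then have "norm \<phi> * norm x \<le> L * norm x" by (rule mult_right_mono) simp
    then show "\<bar>f (C (V h x))\<bar> \<le> L * norm x" using norm_blinfun[of \<phi> x] by (simp add: \<phi>)
  qed
  have "norm (C x) \<le> 2 * L * norm x" if x: "x \<in> Domain ?G" for x
  proof -
    obtain y where xy: "(x, y) \<in> ?G" using x by blast
    have lim: "((\<lambda>h. V h z) \<longlongrightarrow> z) (at_right 0)" for z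
      unfolding V_def by (rule orbit_integral_average_tendsto[OF S(1)])
    have "((\<lambda>h. k * (norm (x - V h x) + norm (y - V h y))) \<longlongrightarrow> k * (norm (x - x) + norm (y - y))) (at_right 0)"
      by (intro tendsto_intros lim)
    then have "((\<lambda>h. k * (norm (x - V h x) + norm (y - V h y)) + 2 * (L * norm x))
        \<longlongrightarrow> k * (norm (x - x) + norm (y - y)) + 2 * (L * norm x)) (at_right 0)"
      by (intro tendsto_add tendsto_const)
    moreover have "norm (C x) \<le> k * (norm (x - V h x) + norm (y - V h y)) + 2 * (L * norm x)"
      if h: "0 < h" "h \<le> 1" for h
    proof -
      \<comment> \<open>The generator commutes with averaging on its domain:
        \<open>(1 / h) *\<^sub>R (S h x - x)\<close> equals \<open>V h y\<close>. Hence
        \<open>V h x\<close> tends to \<open>x\<close> in the graph norm, for which \<open>C\<close>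
        is continuous.\<close>
      have "(V h x, V h y) \<in> ?G"
        using graph_V[of h x] orbit_integral_of_generator[OF S(1) _ xy, of h] h by (simp add: V_def)
      then have "(x - V h x, y - V h y) \<in> ?G"
        using generator_add[OF xy generator_scaleR[of _ _ S "- 1"]] by fastforce
      note d = k[OF this] DomainI[OF this]
      have "C x = C (x - V h x) + C (V h x)" using C_add[OF d(2) dom_V[of h x]] h by simp
      then show ?thesis
        using norm_triangle_ineq[of "C (x - V h x)" "C (V h x)"] d(1) CV[OF h, of x] by simp
    qed
    then have "\<forall>\<^sub>F h in at_right 0. norm (C x) \<le> k * (norm (x - V h x) + norm (y - V h y)) + 2 * (L * norm x)"
      unfolding eventually_at_right_field by (intro exI[of _ 1]) auto
    ultimately have "norm (C x) \<le> k * (norm (x - x) + norm (y - y)) + 2 * (L * norm x)"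
      by (intro tendsto_lowerbound) auto
    then show ?thesis by simp
  qed
  then show thesis by (rule that)
qed

section \<open>Admissibility of observation operators bounded in the norm of the state space\<close>

lemma bounded_observation_Lp_admissible:
  fixes T :: "real \<Rightarrow> 'a::banach \<Rightarrow>\<^sub>L 'a" and C :: "'a \<Rightarrow> 'b::real_normed_vector"
  assumes T: "c0_semigroup T" and "1 \<le> p"
    and C: "graph_bounded_linear (generator T) C"
    and L: "\<And>x. x \<in> Domain (generator T) \<Longrightarrow> norm (C x) \<le> L * norm x"
  shows "Lp_admissible p T (generator T) C"
proof -
  obtain M where M: "1 \<le> M" "\<And>t. 0 \<le> t \<Longrightarrow> t \<le> 1 \<Longrightarrow> norm (T t) \<le> M"
    using c0_semigroup_bounded[OF T] by blast
  \<comment> \<open>Adding 1 makes the constant strictly positive, as the admissibility constant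
    \<open>N * M\<close> must be.\<close>
  define N where "N = \<bar>L\<bar> + 1"
  have N: "norm (C x) \<le> N * norm x" if "x \<in> Domain (generator T)" for x
    using L[OF that] mult_right_mono[OF abs_ge_self[of L], of "norm x"] norm_ge_zero[of x]
    unfolding N_def distrib_right by linarith
  have "0 < N" by (simp add: N_def)
  have "set_integrable lborel {0..1} (\<lambda>t. norm (C (T t x)) powr p) \<and>
      (LINT t:{0..1}|lborel. norm (C (T t x)) powr p) \<le> (N * M) powr p * norm x powr p"
    if x: "x \<in> Domain (generator T)" for x
  proof (intro conjI)
    have dom: "T t x \<in> Domain (generator T)" if "0 \<le> t" for t
      using x generator_semigroup[OF T that] by blast
    \<comment> \<open>By linearity the bound on the domain controls differences along the orbit. The
      observed orbit is thus continuous, which settles integrability.\<close>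
    have lip: "norm (C (T s x) - C (T t x)) \<le> N * norm (T s x - T t x)" if "0 \<le> s" "0 \<le> t" for s t
    proof -
      obtain y z where "(T s x, y) \<in> generator T" "(T t x, z) \<in> generator T"
        using dom \<open>0 \<le> s\<close> \<open>0 \<le> t\<close> by blast
      then have d: "T s x - T t x \<in> Domain (generator T)"
        using generator_add[of "T s x" y T "- T t x" "- z"] generator_scaleR[of "T t x" z T "- 1"] by auto
      have "C (T s x) = C (T s x - T t x) + C (T t x)"
        using C d dom[OF \<open>0 \<le> t\<close>] unfolding graph_bounded_linear_def by (metis diff_add_cancel)
      then show ?thesis using N[OF d] by simp
    qed
    have "continuous_on {0..1} (\<lambda>t. C (T t x))"
      unfolding continuous_on
    proof
      fix t :: real assume t: "t \<in> {0..1}"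
      have "((\<lambda>s. T s x) \<longlongrightarrow> T t x) (at t within {0..1})"
        using c0_semigroup_continuous_on[OF T, of 1 x, unfolded continuous_on] t by (rule bspec)
      then have "((\<lambda>s. N * norm (T s x - T t x)) \<longlongrightarrow> N * norm (T t x - T t x)) (at t within {0..1})"
        by (intro tendsto_mult tendsto_norm tendsto_diff tendsto_const)
      then have lim: "((\<lambda>s. N * norm (T s x - T t x)) \<longlongrightarrow> 0) (at t within {0..1})" by simp
      have "\<forall>\<^sub>F s in at t within {0..1}. norm (C (T s x) - C (T t x)) \<le> N * norm (T s x - T t x)"
        using lip t by (auto simp: eventually_at_filter)
      then have "((\<lambda>s. C (T s x) - C (T t x)) \<longlongrightarrow> 0) (at t within {0..1})"
        by (rule Lim_null_comparison[OF _ lim])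
      then show "((\<lambda>s. C (T s x)) \<longlongrightarrow> C (T t x)) (at t within {0..1})"
        by (simp add: LIM_zero_iff)
    qed
    then have "continuous_on {0..1} (\<lambda>t. norm (C (T t x)) powr p)"
      using \<open>1 \<le> p\<close> by (intro continuous_on_powr' continuous_intros) auto
    then show int: "set_integrable lborel {0..1} (\<lambda>t. norm (C (T t x)) powr p)"
      unfolding set_integrable_def by (intro borel_integrable_compact) auto
    have bound: "norm (C (T t x)) powr p \<le> (N * M * norm x) powr p" if "t \<in> {0..1}" for t
    proof (rule powr_mono2)
      have "norm (T t x) \<le> M * norm x"
        using norm_blinfun[of "T t" x] M(2)[of t] that
        by (meson atLeastAtMost_iff mult_right_mono norm_ge_zero order_trans)
      then have "N * norm (T t x) \<le> N * (M * norm x)" using \<open>0 < N\<close> by (intro mult_left_mono) auto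
      with N[OF dom, of t] that show "norm (C (T t x)) \<le> N * M * norm x" by simp
    qed (use \<open>1 \<le> p\<close> in auto)
    have "(LINT t:{0..1}|lborel. norm (C (T t x)) powr p) \<le> (LINT t:{0..1::real}|lborel. (N * M * norm x) powr p)"
      by (rule set_integral_mono[OF int _ bound]) (simp add: set_integrable_def)
    also have "\<dots> = (N * M) powr p * norm x powr p"
      using \<open>0 < N\<close> M(1) by (simp add: set_lebesgue_integral_def powr_mult)
    finally show "(LINT t:{0..1}|lborel. norm (C (T t x)) powr p) \<le> (N * M) powr p * norm x powr p" .
  qed
  moreover have "0 < N * M" using \<open>0 < N\<close> M(1) by simp
  ultimately show ?thesis using C unfolding Lp_admissible_def by (intro conjI exI[of _ 1] exI[of _ "N * M"]) auto
qed

theorem proposition3p1: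
  fixes T :: "real \<Rightarrow> 'x::banach_lattice \<Rightarrow>\<^sub>L 'x"
    and A :: "('x, 'x) operator_graph"
    and C :: "'x \<Rightarrow> 'y::banach_lattice"
    and p :: real
  assumes "1 \<le> p"
    and "c0_semigroup T" and "positive_semigroup T" and "A = generator T"
    and "densely_defined (adjoint_graph A)"
    and "\<exists>\<mu>\<^sub>0 c. spectral_bound (adjoint_graph A) < ereal \<mu>\<^sub>0 \<and> c > 0 \<and>
           (\<forall>\<phi>\<in>dual_cone. norm (resolvent \<mu>\<^sub>0 (adjoint_graph A) \<phi>) \<ge> c * norm \<phi>)"
    and "graph_bounded_linear A C" and "positive_on_domain A C"
  shows "Lp_admissible p T A C \<and> positive_on_domain A C"
proof -
  note T = \<open>c0_semigroup T\<close> and A = \<open>A = generator T\<close>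
  obtain \<beta> K where "\<And>\<phi>. \<phi> \<in> dual_cone \<Longrightarrow>
      norm \<phi> \<le> K * norm (\<phi> o\<^sub>L Blinfun (orbit_integral (rescaled \<beta> T) 1))"
    using assms(6) inverse_estimate_orbit_integral[OF T] unfolding A by metis
  moreover have "graph_bounded_linear (generator (rescaled \<beta> T)) C"
    using assms(7) unfolding A by (rule graph_bounded_linear_rescaled)
  moreover have "positive_on_domain (generator (rescaled \<beta> T)) C"
    using assms(8) unfolding A positive_on_domain_def Domain_generator_rescaled .
  ultimately obtain L where "\<And>x. x \<in> Domain (generator (rescaled \<beta> T)) \<Longrightarrow> norm (C x) \<le> L * norm x"
    using positive_observation_bounded[OF c0_semigroup_rescaled[OF T]
        positive_semigroup_rescaled[OF assms(3)]] by blast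
  \<comment> \<open>The rescaled generator has the same domain, so the bound on \<open>C\<close>
    carries over unchanged to \<open>T\<close> itself.\<close>
  then have "Lp_admissible p T A C"
    using assms(1,7) unfolding A Domain_generator_rescaled
    by (intro bounded_observation_Lp_admissible[OF T])
  then show ?thesis using assms(8) ..
qed

end
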